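(* Let $d\ge 1$, let $\mathcal{K}_{\log}\subset\mathbb{R}\times\mathbb{R}\times\mathbb{R}^d$ be the logarithm cone with barrier $f$, and let $g^\ast$ denote its conjugate gradient (all defined in the context). For every $(p,q,r)\in\operatorname{int}(\mathcal{K}_{\log}^\ast)$, the components of $g^\ast=g^\ast(p,q,r)$ are $$g^\ast_p=\frac{-d-2+\frac{q}{p}+2\bar\omega}{p(1-\bar\omega)},\qquad g^\ast_q=-\frac{1}{p(1-\bar\omega)},\qquad g^\ast_{r_i}=\frac{\bar\omega}{r_i(1-\bar\omega)}\quad (i=1,\dots,d),$$ where $$\bar\omega := d\cdot\omega\Bigl(\tfrac1d\Bigl(1+d-\tfrac{q}{p}+\sum_{i=1}^d\log\bigl(-\tfrac{r_i}{p}\bigr)\Bigr)-\log(d)\Bigr)$$ and $\omega$ is the Wright omega function.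
   Context: For a closed, convex, pointed, full-dimensional cone $\mathcal{K}$ in a finite-dimensional real inner product space, the dual cone is $\mathcal{K}^\ast=\{s:\langle w,s\rangle\ge 0\ \forall w\in\mathcal{K}\}$. Given a barrier function $f:\operatorname{int}(\mathcal{K})\to\mathbb{R}$, the conjugate barrier is $f^\ast(s)=\sup_{w\in\operatorname{int}(\mathcal{K})}\{-\langle s,w\rangle-f(w)\}$ for $s\in\operatorname{int}(\mathcal{K}^\ast)$, and the conjugate gradient $g^\ast$ is the gradient of $f^\ast$; equivalently $g^\ast(s)=-\operatorname{argsup}_{w\in\operatorname{int}(\mathcal{K})}\{-\langle s,w\rangle-f(w)\}$. The standard inner product is used. Let $\varphi(w)=\sum_{i=1}^d\log w_i$ for $w\in\mathbb{R}^d_{++}$ (vectors with positive entries). The logarithm cone is $$\mathcal{K}_{\log}=\operatorname{cl}\{(u,v,w)\in\mathbb{R}\times\mathbb{R}_{++}\times\mathbb{R}^d_{++}: u\le v\varphi(w/v)\},$$ with barrier $f(u,v,w)=-\log(v\varphi(w/v)-u)-\log(v)-\sum_{i=1}^d\log(w_i)$. Its dual cone is $$\mathcal{K}_{\log}^\ast=\operatorname{cl}\{(p,q,r)\in\mathbb{R}_{--}\times\mathbb{R}\times\mathbb{R}^d_{++}: q\ge p\sum_{i=1}^d\log(-r_i/p)+pd\},$$ where $\mathbb{R}_{--}$ denotes the negative reals. Subscripts $p,q,r_i$ on $g^\ast$ denote the corresponding components. For real $\beta$, the Wright omega function $\omega(\beta)$ is the unique positive real satisfying $\omega(\beta)+\log(\omega(\beta))=\beta$.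 *)

theory Defs
  imports "HOL-Analysis.Analysis"
begin

definition dual_cone :: "'a::real_inner set \<Rightarrow> 'a set" where
  "dual_cone K = {s. \<forall>w\<in>K. w \<bullet> s \<ge> 0}"

definition conj_barrier :: "'a::real_inner set \<Rightarrow> ('a \<Rightarrow> real) \<Rightarrow> 'a \<Rightarrow> real" where
  "conj_barrier K f s = (SUP w\<in>interior K. - (s \<bullet> w) - f w)"

definition conj_gradient :: "'a::real_inner set \<Rightarrow> ('a \<Rightarrow> real) \<Rightarrow> 'a \<Rightarrow> 'a" where
  "conj_gradient K f s = (THE g. GDERIV (conj_barrier K f) s :> g)"

definition wright_omega :: "real \<Rightarrow> real" where
  "wright_omega \<beta> = (THE y. y > 0 \<and> y + ln y = \<beta>)"

definition sum_log :: "real ^ 'd \<Rightarrow> real" where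
  "sum_log w = (\<Sum>i\<in>UNIV. ln (w $ i))"

definition log_cone :: "(real \<times> real \<times> (real ^ 'd)) set" where
  "log_cone = closure {(u, v, w). v > 0 \<and> (\<forall>i. w $ i > 0) \<and> u \<le> v * sum_log (w /\<^sub>R v)}"

text \<open>Only the values on \<^term>\<open>interior log_cone\<close> are meaningful; elsewhere the logarithms
  may be applied to nonpositive arguments.\<close>

definition log_barrier :: "real \<times> real \<times> (real ^ 'd) \<Rightarrow> real" where
  "log_barrier = (\<lambda>(u, v, w).
     - ln (v * sum_log (w /\<^sub>R v) - u) - ln v - (\<Sum>i\<in>UNIV. ln (w $ i)))"

definition omega_bar :: "real \<Rightarrow> real \<Rightarrow> real ^ 'd \<Rightarrow> real" where
  "omega_bar p q r =
     real CARD('d) * wright_omega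
       (1 / real CARD('d) * (1 + real CARD('d) - q / p + (\<Sum>i\<in>UNIV. ln (- (r $ i) / p)))
        - ln (real CARD('d)))"

end

theory Submission
  imports Defs
begin

text \<open>
  The conjugate barrier is a supremum of the affine functions \<open>s \<mapsto> - (s \<bullet> w) - f w\<close>.  If, for
  all parameters \<open>t\<close> near \<open>s\<close>, the supremum is attained at a point \<open>x t\<close>, and \<open>x\<close> is continuous
  at \<open>s\<close>, then its gradient is the slope \<open>- x s\<close> of the affine function that attains it (\<open>GDERIV_conj_barrier\<close>).  It therefore suffices to
  exhibit a maximizer that depends continuously on \<open>(p, q, r)\<close>.

  Let \<open>\<zeta> = v * \<phi> (w / v) - u\<close>.  The stationarity equations of the concave objective are
  \<open>\<zeta> = - 1 / p\<close>, \<open>r\<^sub>i * w\<^sub>i = 1 - p * v\<close> and \<open>1 / v = q + p * (\<phi> (w / v) - d)\<close>.  Parametrise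
  \<open>1 / v = p * (1 - \<omega>)\<close>; then \<open>w\<^sub>i = \<omega> / (r\<^sub>i * (\<omega> - 1))\<close> and hence
  \<open>\<phi> (w / v) = d * ln \<omega> - (\<Sum>i. ln (- r\<^sub>i / p))\<close>, so the last equation becomes
  \<open>\<omega> + d * ln \<omega> = 1 + d - q / p + (\<Sum>i. ln (- r\<^sub>i / p))\<close>.
  Its solution is the number \<open>omega_bar\<close> (\<open>omega_bar_equation\<close>).  In the interior of the dual cone
  the right-hand side exceeds \<open>1\<close>, so \<open>\<omega> > 1\<close> (\<open>omega_bar_gt_one\<close>), which is exactly what makes
  \<open>v\<close> and all \<open>w\<^sub>i\<close> positive.

  That the stationary point is a global maximum follows by bounding every logarithm by its tangent
  at that point: stationarity makes all linear terms cancel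
  (\<open>log_barrier_stationary_point_maximal\<close>).  Continuity of the maximizer comes down to continuity of
  the Wright omega function, which is \<open>1\<close>-Lipschitz because \<open>y + ln y\<close> has derivative at least \<open>1\<close>.
\<close>

section \<open>Gradients of suprema\<close>

lemma GDERIV_unique:
  assumes "GDERIV f x :> g" and "GDERIV f x :> g'"
  shows "g = g'"
proof -
  have "(\<lambda>h. h \<bullet> g) = (\<lambda>h. h \<bullet> g')"
    using assms has_derivative_unique unfolding gderiv_def by blast
  then have "(g - g') \<bullet> g = (g - g') \<bullet> g'" by metis
  then have "(g - g') \<bullet> (g - g') = 0" by (simp add: inner_diff_right)
  then show ?thesis by simp
qed

lemma conj_gradient_eqI:
  assumes "GDERIV (conj_barrier K f) s :> g"
  shows "conj_gradient K f s = g"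
  unfolding conj_gradient_def using assms GDERIV_unique by blast

lemma conj_barrier_eq_maximum:
  assumes "x \<in> interior K"
    and "\<And>w. w \<in> interior K \<Longrightarrow> - (s \<bullet> w) - f w \<le> - (s \<bullet> x) - f x"
  shows "conj_barrier K f s = - (s \<bullet> x) - f x"
  unfolding conj_barrier_def using assms by (intro cSup_eq_maximum) auto

text \<open>
  An envelope theorem.  Comparing the maximizers of two parameters \<open>s\<close> and \<open>t\<close> in each other's
  problem confines the linearization error at \<open>t\<close> between \<open>0\<close> and \<open>(s - t) \<bullet> (x t - x s)\<close>, which is
  \<open>o(norm (t - s))\<close> because \<open>x\<close> is continuous at \<open>s\<close>.
\<close>
lemma GDERIV_conj_barrier:
  fixes K :: "'a::real_inner set" and x :: "'a \<Rightarrow> 'a"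
  assumes U: "open U" "s \<in> U"
    and x_in: "\<And>t. t \<in> U \<Longrightarrow> x t \<in> interior K"
    and x_max: "\<And>t w. t \<in> U \<Longrightarrow> w \<in> interior K \<Longrightarrow> - (t \<bullet> w) - f w \<le> - (t \<bullet> x t) - f (x t)"
    and x_cont: "isCont x s"
  shows "GDERIV (conj_barrier K f) s :> - x s"
proof -
  let ?F = "conj_barrier K f"
  have F: "?F t = - (t \<bullet> x t) - f (x t)" if "t \<in> U" for t
    using that by (intro conj_barrier_eq_maximum x_in x_max)
  obtain e where e: "e > 0" "ball s e \<subseteq> U"
    using U open_contains_ball by blast
  have bound: "norm (?F t - ?F s - (t - s) \<bullet> - x s) / norm (t - s) \<le> norm (x t - x s)"
    if t: "t \<noteq> s" "dist t s < e" for t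
  proof -
    have tU: "t \<in> U" using e(2) t(2) by (auto simp: dist_commute)
    have "- (t \<bullet> x s) - f (x s) \<le> ?F t" "- (s \<bullet> x t) - f (x t) \<le> ?F s"
      using x_max[OF tU x_in[OF U(2)]] x_max[OF U(2) x_in[OF tU]] F[OF tU] F[OF U(2)] by simp_all
    then have "0 \<le> ?F t - ?F s - (t - s) \<bullet> - x s"
      and "?F t - ?F s - (t - s) \<bullet> - x s \<le> (s - t) \<bullet> (x t - x s)"
      using F[OF tU] F[OF U(2)] by (simp_all add: inner_diff_left inner_diff_right)
    moreover have "(s - t) \<bullet> (x t - x s) \<le> norm (s - t) * norm (x t - x s)"
      by (rule norm_cauchy_schwarz)
    ultimately show ?thesis
      using t(1) by (simp add: divide_le_eq norm_minus_commute mult.commute)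
  qed
  have "((\<lambda>t. norm (x t - x s)) \<longlongrightarrow> 0) (at s)"
    using x_cont unfolding isCont_def by (simp add: LIM_zero tendsto_norm_zero)
  then show ?thesis
    unfolding gderiv_def
    by (intro has_derivativeI_sandwich[OF e(1) bounded_linear_inner_left, where H = "\<lambda>t. norm (x t - x s)"])
       (use bound in auto)
qed

section \<open>The Wright omega function\<close>

text \<open>
  Both summands are increasing, so neither can offset the growth of the other.  This gives
  uniqueness in the definition of the Wright omega function and the Lipschitz bound for it.
\<close>
lemma self_plus_ln_expansive:
  fixes x y :: real
  assumes "0 < x" "0 < y"
  shows "\<bar>x - y\<bar> \<le> \<bar>(x + ln x) - (y + ln y)\<bar>"
proof (cases "x \<le> y")
  case True
  then have "ln x \<le> ln y" using assms by simp
  then show ?thesis using True by simp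
next
  case False
  then have "ln y \<le> ln x" using assms by simp
  then show ?thesis using False by simp
qed

lemma wright_omega:
  shows "0 < wright_omega \<beta>" and "wright_omega \<beta> + ln (wright_omega \<beta>) = \<beta>"
proof -
  have "\<exists>y. y > 0 \<and> y + ln y = \<beta>"
  proof -
    \<comment> \<open>at most \<open>\<beta>\<close> at \<open>a\<close>, since \<open>a \<le> 1\<close> and \<open>ln a \<le> \<beta> - 1\<close>; at least \<open>\<beta>\<close> at \<open>b\<close>, since \<open>ln b \<ge> 0\<close>\<close>
    define a where "a = min 1 (exp (\<beta> - 1))"
    define b where "b = max 1 \<beta>"
    have a: "0 < a" "a \<le> 1" "1 \<le> b" "\<beta> \<le> b" by (auto simp: a_def b_def)
    have "ln a \<le> ln (exp (\<beta> - 1))"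
      using a(1) by (subst ln_le_cancel_iff) (auto simp: a_def)
    then have "a + ln a \<le> \<beta>" using a by simp
    moreover have "\<beta> \<le> b + ln b" using a ln_ge_zero[of b] by linarith
    moreover have "continuous_on {a..b} (\<lambda>y. y + ln y)"
      using a by (intro continuous_intros) auto
    ultimately obtain y where "a \<le> y" "y + ln y = \<beta>"
      using IVT'[of "\<lambda>y. y + ln y" a \<beta> b] a by auto
    then show ?thesis using a by (intro exI[of _ y]) auto
  qed
  moreover have "x = y" if "x > 0 \<and> x + ln x = \<beta>" "y > 0 \<and> y + ln y = \<beta>" for x y
    using self_plus_ln_expansive[of x y] that by simp
  ultimately have "\<exists>!y. y > 0 \<and> y + ln y = \<beta>" by blast
  from theI'[OF this] show "0 < wright_omega \<beta>" "wright_omega \<beta> + ln (wright_omega \<beta>) = \<beta>"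
    unfolding wright_omega_def by auto
qed

lemma isCont_wright_omega: "isCont wright_omega \<beta>"
proof -
  have lip: "dist (wright_omega a) (wright_omega b) \<le> dist a b" for a b
    using self_plus_ln_expansive[OF wright_omega(1) wright_omega(1), of a b]
    by (simp add: wright_omega(2) dist_real_def)
  show ?thesis
    unfolding continuous_at_eps_delta using lip by (meson le_less_trans)
qed

text \<open>
  Scaling by \<open>d\<close> turns the defining equation \<open>y + ln y = \<beta>\<close> into the stationarity equation of the
  barrier problem: with \<open>\<omega> = d * y\<close>, the shift \<open>- ln d\<close> in \<open>\<beta>\<close> absorbs \<open>ln y = ln \<omega> - ln d\<close>.
\<close>
lemma omega_bar_equation:
  fixes r :: "real ^ 'd"
  shows "0 < omega_bar p q r"
    and "omega_bar p q r + real CARD('d) * ln (omega_bar p q r)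
         = 1 + real CARD('d) - q / p + (\<Sum>i\<in>UNIV. ln (- (r $ i) / p))"
proof -
  define d where "d = real CARD('d)"
  define B where "B = 1 + d - q / p + (\<Sum>i\<in>UNIV. ln (- (r $ i) / p))"
  define y where "y = wright_omega (1 / d * B - ln d)"
  have d: "d > 0" by (simp add: d_def)
  have \<omega>: "omega_bar p q r = d * y" by (simp add: omega_bar_def d_def y_def B_def)
  have y: "0 < y" "y + ln y = 1 / d * B - ln d" unfolding y_def by (rule wright_omega)+
  show "0 < omega_bar p q r" using y d by (simp add: \<omega>)
  have "d * (y + ln y) = B - d * ln d" unfolding y(2) using d by (simp add: right_diff_distrib)
  then show "omega_bar p q r + real CARD('d) * ln (omega_bar p q r)
         = 1 + real CARD('d) - q / p + (\<Sum>i\<in>UNIV. ln (- (r $ i) / p))"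
    unfolding \<omega> d_def[symmetric] B_def[symmetric] using d y(1)
    by (simp add: ln_mult algebra_simps)
qed

section \<open>The interiors of the logarithm cone and of its dual\<close>

text \<open>The argument of the first logarithm in the barrier: the slack of the inequality that defines
  the cone.\<close>
definition log_gap :: "real \<times> real \<times> (real ^ 'd) \<Rightarrow> real" where
  "log_gap = (\<lambda>(u, v, w). v * sum_log (w /\<^sub>R v) - u)"

text \<open>The open set on which the gap is continuous, so that the cone is there described by the
  sign of the gap alone.\<close>
definition log_domain :: "(real \<times> real \<times> (real ^ 'd)) set" where
  "log_domain = {(u, v, w). 0 < v \<and> (\<forall>i. 0 < w $ i)}"

lemma log_cone_eq: "log_cone = closure {x \<in> log_domain. 0 \<le> log_gap x}"
  unfolding log_cone_def by (rule arg_cong[where f = closure]) (auto simp: log_domain_def log_gap_def)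

lemma sum_log_scaled: "sum_log (w /\<^sub>R v) = (\<Sum>i\<in>UNIV. ln (w $ i / v))"
  by (simp add: sum_log_def divide_inverse mult.commute)

lemma open_log_domain: "open (log_domain :: (real \<times> real \<times> (real ^ 'd)) set)"
proof -
  have "log_domain = (\<Inter>i::'d. {x :: real \<times> real \<times> (real ^ 'd). 0 < fst (snd x)} \<inter> {x. 0 < snd (snd x) $ i})"
    by (auto simp: log_domain_def)
  also have "open \<dots>"
    by (intro open_INT ballI open_Int open_Collect_less continuous_intros) auto
  finally show ?thesis .
qed

lemma continuous_on_log_gap:
  "continuous_on log_domain (log_gap :: real \<times> real \<times> (real ^ 'd) \<Rightarrow> real)"
proof -
  have "(\<lambda>x :: real \<times> real \<times> (real ^ 'd). fst (snd x) * (\<Sum>i\<in>UNIV. ln (snd (snd x) $ i / fst (snd x))) - fst x) = (log_gap :: real \<times> real \<times> (real ^ 'd) \<Rightarrow> real)"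
    by (auto simp: log_gap_def sum_log_scaled fun_eq_iff)
  moreover have "continuous_on log_domain
      (\<lambda>x :: real \<times> real \<times> (real ^ 'd). fst (snd x) * (\<Sum>i\<in>UNIV. ln (snd (snd x) $ i / fst (snd x))) - fst x)"
    by (intro continuous_intros) (auto simp: log_domain_def less_imp_neq dest: less_imp_neq[THEN not_sym])
  ultimately show ?thesis by metis
qed

lemma open_log_gap_vimage:
  fixes B :: "real set"
  assumes "open B"
  shows "open {x \<in> log_domain :: (real \<times> real \<times> (real ^ 'd)) set. log_gap x \<in> B}"
proof -
  have "open (log_gap -` B \<inter> (log_domain :: (real \<times> real \<times> (real ^ 'd)) set))"
    using continuous_on_open_vimage[OF open_log_domain] continuous_on_log_gap assms by blast
  moreover have "log_gap -` B \<inter> (log_domain :: (real \<times> real \<times> (real ^ 'd)) set)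
      = {x \<in> log_domain. log_gap x \<in> B}" by auto
  ultimately show ?thesis by simp
qed

text \<open>A nonzero linear functional that is nonnegative on a set is positive in its interior.  All
  strict inequalities for the two cones below come from weak ones in this way.\<close>
lemma interior_halfspace_pos:
  fixes a :: "'a::euclidean_space"
  assumes "x \<in> interior S" and "S \<subseteq> {y. a \<bullet> y \<ge> 0}" and "a \<noteq> 0"
  shows "a \<bullet> x > 0"
  using interior_mono[OF assms(2)] assms(1,3) by auto

text \<open>
  The closure adds only points with \<open>v = 0\<close> or \<open>w\<^sub>i = 0\<close>, but these lie on the boundary, as the cone is
  contained in the corresponding half-spaces.  Where \<open>v\<close> and \<open>w\<close> are positive the gap is continuous,
  so it stays nonnegative in the closure; at an interior point \<open>u\<close> can still be increased, hence the
  gap is positive there.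
\<close>
lemma interior_log_cone:
  "interior log_cone = {x \<in> log_domain :: (real \<times> real \<times> (real ^ 'd)) set. 0 < log_gap x}"
proof (rule antisym)
  let ?S = "{x \<in> log_domain :: (real \<times> real \<times> (real ^ 'd)) set. 0 \<le> log_gap x}"
  have "{x \<in> log_domain :: (real \<times> real \<times> (real ^ 'd)) set. 0 < log_gap x} \<subseteq> log_cone"
    unfolding log_cone_eq using closure_subset[of ?S] by auto
  moreover have "open {x \<in> log_domain :: (real \<times> real \<times> (real ^ 'd)) set. 0 < log_gap x}"
    using open_log_gap_vimage[of "{0<..}"] by simp
  ultimately show "{x \<in> log_domain :: (real \<times> real \<times> (real ^ 'd)) set. 0 < log_gap x} \<subseteq> interior log_cone"
    by (rule interior_maximal)
  show "interior log_cone \<subseteq> {x \<in> log_domain :: (real \<times> real \<times> (real ^ 'd)) set. 0 < log_gap x}"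
  proof
    fix x :: "real \<times> real \<times> (real ^ 'd)"
    assume x: "x \<in> interior log_cone"
    obtain u v w where xe: "x = (u, v, w)" by (cases x)
    have half: "a \<bullet> x > 0" if "a \<noteq> 0" "\<And>y. y \<in> ?S \<Longrightarrow> a \<bullet> y \<ge> 0" for a
    proof (rule interior_halfspace_pos[OF x _ that(1)])
      show "log_cone \<subseteq> {y. a \<bullet> y \<ge> 0}"
        unfolding log_cone_eq using that(2) by (intro closure_minimal closed_halfspace_ge) auto
    qed
    have "0 < v"
      using half[of "(0, 1, 0)"] by (auto simp: xe log_domain_def zero_prod_def)
    moreover have "0 < w $ i" for i
    proof -
      have "0 < (0, 0, axis i 1) \<bullet> x"
        by (rule half) (auto simp: log_domain_def zero_prod_def inner_axis' intro: less_imp_le)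
      then show ?thesis by (simp add: xe inner_axis')
    qed
    ultimately have dom: "(t, v, w) \<in> log_domain" for t by (simp add: log_domain_def)
    obtain e where e: "e > 0" "ball x e \<subseteq> log_cone"
      using x mem_interior by blast
    have "(u + e / 2, v, w) \<in> ball x e" using e(1) by (simp add: xe dist_Pair_Pair dist_real_def)
    then have cl: "(u + e / 2, v, w) \<in> closure ?S" using e(2) log_cone_eq by blast
    have "0 \<le> log_gap (u + e / 2, v, w)"
    proof (rule ccontr)
      let ?N = "{x \<in> log_domain :: (real \<times> real \<times> (real ^ 'd)) set. log_gap x < 0}"
      assume "\<not> ?thesis"
      then have "(u + e / 2, v, w) \<in> ?N" using dom by simp
      moreover have "open ?N" using open_log_gap_vimage[of "{..<0}"] by simp
      moreover have "?N \<inter> ?S = {}" by auto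
      ultimately show False using cl open_Int_closure_eq_empty[of ?N ?S] by blast
    qed
    then have "0 < log_gap x" using e(1) by (simp add: xe log_gap_def)
    then show "x \<in> {x \<in> log_domain. 0 < log_gap x}" using dom by (simp add: xe)
  qed
qed

lemma interior_dual_cone_inner_pos:
  fixes K :: "'a::euclidean_space set"
  assumes "s \<in> interior (dual_cone K)" and "w \<in> K" and "w \<noteq> 0"
  shows "w \<bullet> s > 0"
  using interior_halfspace_pos[OF assms(1) _ assms(3)] assms(2) by (auto simp: dual_cone_def)

lemma nonneg_coefficient_if_bounded_below:
  fixes a b :: real
  assumes "\<And>M. 1 \<le> M \<Longrightarrow> 0 \<le> M * a + b"
  shows "0 \<le> a"
proof (rule ccontr)
  assume "\<not> 0 \<le> a"
  then have a: "a < 0" by simp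
  define M where "M = 1 + \<bar>b\<bar> / - a"
  have "1 \<le> M" using a by (simp add: M_def divide_nonneg_neg)
  moreover have "M * a = a - \<bar>b\<bar>" using a by (simp add: M_def left_diff_distrib)
  then have "M * a + b < 0" using a by linarith
  ultimately show False using assms by fastforce
qed

text \<open>
  Each inequality results from testing against suitable cone elements: \<open>p \<le> 0\<close> from letting
  \<open>u \<rightarrow> -\<infinity>\<close> with \<open>v\<close> and \<open>w\<close> fixed, \<open>r\<^sub>i \<ge> 0\<close> from letting \<open>w\<^sub>i \<rightarrow> \<infinity>\<close>, and the bound on \<open>q\<close>
  from the boundary point with \<open>v = 1\<close> and \<open>w\<^sub>i = - p / r\<^sub>i\<close>, which minimizes the pairing among the
  boundary points \<open>(\<phi> w, 1, w)\<close>.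
\<close>
lemma interior_dual_log_cone:
  fixes r :: "real ^ 'd"
  assumes s: "(p, q, r) \<in> interior (dual_cone log_cone)"
  shows "p < 0" and "\<And>i. 0 < r $ i"
    and "p * (\<Sum>i\<in>UNIV. ln (- (r $ i) / p)) + p * real CARD('d) < q"
proof -
  have in_cone: "(u, v, w) \<in> log_cone" if "0 < v" "\<And>i. 0 < w $ i" "u \<le> v * sum_log (w /\<^sub>R v)"
    for u v and w :: "real ^ 'd"
    unfolding log_cone_eq by (rule closure_subset[THEN subsetD]) (use that in \<open>simp add: log_domain_def log_gap_def\<close>)
  have dual: "0 \<le> u * y + v * z + w \<bullet> t"
    if "0 < v" "\<And>i. 0 < w $ i" "u \<le> v * sum_log (w /\<^sub>R v)" "(y, z, t) \<in> dual_cone log_cone"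
    for u v y z and w t :: "real ^ 'd"
    using in_cone[OF that(1-3)] that(4) by (auto simp: dual_cone_def)
  have "0 < (- 1, 0, 0) \<bullet> (p, q, r)"
  proof (rule interior_halfspace_pos[OF s])
    show "dual_cone log_cone \<subseteq> {x :: real \<times> real \<times> (real ^ 'd). 0 \<le> (- 1, 0, 0) \<bullet> x}"
    proof safe
      fix y z and t :: "real ^ 'd" assume yzt: "(y, z, t) \<in> dual_cone log_cone"
      have "0 \<le> M * (- y) + (z + 1 \<bullet> t)" if "1 \<le> M" for M
      proof -
        have "0 \<le> - M * y + 1 * z + 1 \<bullet> t"
          using that by (intro dual[OF _ _ _ yzt]) (auto simp: sum_log_def)
        then show ?thesis by simp
      qed
      then show "0 \<le> (- 1, 0, 0) \<bullet> (y, z, t)"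
        using nonneg_coefficient_if_bounded_below[of "- y" "z + 1 \<bullet> t"] by simp
    qed
  qed (simp add: zero_prod_def)
  then show p: "p < 0" by simp
  show r: "0 < r $ i" for i
  proof -
    have "0 < (0, 0, axis i 1) \<bullet> (p, q, r)"
    proof (rule interior_halfspace_pos[OF s])
      show "dual_cone log_cone \<subseteq> {x :: real \<times> real \<times> (real ^ 'd). 0 \<le> (0, 0, axis i 1) \<bullet> x}"
      proof safe
        fix y z and t :: "real ^ 'd" assume yzt: "(y, z, t) \<in> dual_cone log_cone"
        have "0 \<le> M * t $ i + (z + 1 \<bullet> t)" if M: "1 \<le> M" for M
        proof -
          define w :: "real ^ 'd" where "w = 1 + axis i M"
          have w: "1 \<le> w $ j" for j using M by (simp add: w_def axis_def)
          have "0 \<le> sum_log w" unfolding sum_log_def using w by (intro sum_nonneg ln_ge_zero) auto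
          then have "0 \<le> 0 * y + 1 * z + w \<bullet> t"
            by (intro dual[OF _ _ _ yzt]) (use less_le_trans[OF zero_less_one w] in auto)
          then show ?thesis by (simp add: w_def inner_add_left inner_axis')
        qed
        then show "0 \<le> (0, 0, axis i 1) \<bullet> (y, z, t)"
          using nonneg_coefficient_if_bounded_below[of "t $ i" "z + 1 \<bullet> t"] by (simp add: inner_axis')
      qed
    qed (simp add: zero_prod_def)
    then show ?thesis by (simp add: inner_axis')
  qed
  define w :: "real ^ 'd" where "w = (\<chi> i. - p / r $ i)"
  have w: "0 < w $ i" "ln (w $ i) = - ln (- (r $ i) / p)" "w $ i * r $ i = - p" for i
    using p r[of i] by (auto simp: w_def ln_div divide_less_0_iff ln_minus)
  have "0 < (sum_log w, 1, w) \<bullet> (p, q, r)"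
    using w by (intro interior_dual_cone_inner_pos[OF s] in_cone) (auto simp: zero_prod_def)
  then show "p * (\<Sum>i\<in>UNIV. ln (- (r $ i) / p)) + p * real CARD('d) < q"
    using w(3) by (simp add: sum_log_def w(2) inner_vec_def sum_negf algebra_simps)
qed

text \<open>The function \<open>\<omega> + d * ln \<omega>\<close> is at most \<open>1\<close> for \<open>\<omega> \<le> 1\<close>, whereas the bound on \<open>q\<close> in the
  interior of the dual cone says precisely that its value at \<open>omega_bar\<close> exceeds \<open>1\<close>.\<close>
lemma omega_bar_gt_one:
  fixes r :: "real ^ 'd"
  assumes "(p, q, r) \<in> interior (dual_cone log_cone)"
  shows "1 < omega_bar p q r"
proof (rule ccontr)
  let ?L = "\<Sum>i\<in>UNIV. ln (- (r $ i) / p)"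
  assume "\<not> 1 < omega_bar p q r"
  then have "omega_bar p q r \<le> 1" "ln (omega_bar p q r) \<le> 0"
    using omega_bar_equation(1)[of p q r] by auto
  then have "omega_bar p q r + real CARD('d) * ln (omega_bar p q r) \<le> 1"
    by (smt (verit) mult_nonneg_nonpos of_nat_0_le_iff)
  moreover have "q / p < ?L + real CARD('d)"
    using interior_dual_log_cone(1,3)[OF assms] by (simp add: neg_divide_less_eq algebra_simps)
  ultimately show False using omega_bar_equation(2)[of p q r] by linarith
qed

section \<open>The maximizer\<close>

lemma ln_le_tangent:
  fixes x y :: real
  assumes "0 < x" "0 < y"
  shows "ln x \<le> ln y + x / y - 1"
  using ln_diff_le[OF assms] assms by (simp add: diff_divide_distrib)

text \<open>
  In terms of the gap \<open>\<zeta>\<close>, the objective is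
  \<open>p * \<zeta> + ln \<zeta> - p * v * (\<Sum>i. ln (w\<^sub>i / v)) - q * v - r \<bullet> w + ln v + (\<Sum>i. ln w\<^sub>i)\<close>, where \<open>- p * v > 0\<close>
  multiplies the logarithms.  Replacing every logarithm by its tangent at the stationary point (at
  \<open>- 1 / p\<close> for \<open>ln \<zeta>\<close>) therefore only increases it.  The products with \<open>v\<close> stay
  linear, since \<open>v * (w\<^sub>i / v) = w\<^sub>i\<close>, and the assumptions \<open>stat_w\<close> and \<open>stat_v\<close> say that the
  coefficients of \<open>w\<^sub>i\<close> and \<open>v\<close> vanish.  The constant that remains is the value at the
  stationary point.
\<close>
lemma log_barrier_stationary_point_maximal:
  fixes r w w0 :: "real ^ 'd"
  assumes p: "p < 0" and v0: "0 < v0" and w0: "\<And>i. 0 < w0 $ i"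
    and stat_w: "\<And>i. r $ i * w0 $ i = 1 - p * v0"
    and stat_v: "q = 1 / v0 - p * (sum_log (w0 /\<^sub>R v0) - real CARD('d))"
    and u0: "u0 = v0 * sum_log (w0 /\<^sub>R v0) + 1 / p"
    and x: "(u, v, w) \<in> log_domain" "0 < log_gap (u, v, w)"
  shows "- ((p, q, r) \<bullet> (u, v, w)) - log_barrier (u, v, w)
       \<le> - ((p, q, r) \<bullet> (u0, v0, w0)) - log_barrier (u0, v0, w0)"
proof -
  define d where "d = real CARD('d)"
  define \<phi> \<phi>0 where "\<phi> = sum_log (w /\<^sub>R v)" and "\<phi>0 = sum_log (w0 /\<^sub>R v0)"
  define \<zeta> where "\<zeta> = v * \<phi> - u"
  define T where "T = (\<Sum>i\<in>UNIV. w $ i / w0 $ i)"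
  define l0 where "l0 = (\<Sum>i\<in>UNIV. ln (w0 $ i))"
  have v: "0 < v" and w: "\<And>i. 0 < w $ i" and \<zeta>: "0 < \<zeta>"
    using x by (auto simp: log_domain_def log_gap_def \<zeta>_def \<phi>_def)
  have rw: "r \<bullet> w = (1 - p * v0) * T"
  proof -
    have "r $ i * w $ i = (1 - p * v0) * (w $ i / w0 $ i)" for i
      unfolding stat_w[of i, symmetric] using w0[of i] by simp
    then show ?thesis by (simp add: inner_vec_def T_def sum_distrib_left)
  qed
  have rw0: "r \<bullet> w0 = d * (1 - p * v0)" by (simp add: inner_vec_def stat_w d_def)
  have \<phi>_le: "\<phi> \<le> \<phi>0 + v0 / v * T - d"
  proof -
    have "\<phi> \<le> (\<Sum>i\<in>UNIV. ln (w0 $ i / v0) + (w $ i / v) / (w0 $ i / v0) - 1)"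
      unfolding \<phi>_def sum_log_scaled by (intro sum_mono ln_le_tangent divide_pos_pos w w0 v v0)
    also have "\<dots> = \<phi>0 + v0 / v * T - d"
      by (simp add: \<phi>0_def sum_log_scaled T_def d_def sum.distrib sum_subtractf sum_distrib_left mult.commute)
    finally show ?thesis .
  qed
  have "(- p * v) * \<phi> \<le> (- p * v) * (\<phi>0 + v0 / v * T - d)"
    using \<phi>_le p v by (intro mult_left_mono) (auto simp: mult_le_0_iff)
  also have "\<dots> = - p * v * \<phi>0 - p * v0 * T + p * v * d"
    using v by (simp add: field_simps)
  finally have 1: "- p * v * \<phi> \<le> - p * v * \<phi>0 - p * v0 * T + p * v * d" by simp
  have 2: "ln \<zeta> \<le> ln (- 1 / p) - p * \<zeta> - 1"
    using ln_le_tangent[of \<zeta> "- 1 / p"] \<zeta> p by (simp add: mult.commute divide_neg_neg)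
  have 3: "ln v \<le> ln v0 + v / v0 - 1" using v v0 by (rule ln_le_tangent)
  have 4: "(\<Sum>i\<in>UNIV. ln (w $ i)) \<le> l0 + T - d"
  proof -
    have "(\<Sum>i\<in>UNIV. ln (w $ i)) \<le> (\<Sum>i\<in>UNIV. ln (w0 $ i) + w $ i / w0 $ i - 1)"
      by (intro sum_mono ln_le_tangent w w0)
    then show ?thesis by (simp add: l0_def T_def d_def sum.distrib sum_subtractf)
  qed
  have qv: "q * v = v / v0 - p * v * \<phi>0 + p * v * d"
    by (simp add: stat_v \<phi>0_def d_def algebra_simps)
  have qv0: "q * v0 = 1 - p * v0 * \<phi>0 + p * v0 * d"
    using v0 by (simp add: stat_v \<phi>0_def d_def algebra_simps)
  have pu: "p * u = p * v * \<phi> - p * \<zeta>" by (simp add: \<zeta>_def algebra_simps)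
  have pu0: "p * u0 = p * v0 * \<phi>0 + 1" using p by (simp add: u0 \<phi>0_def algebra_simps)
  have "- ((p, q, r) \<bullet> (u, v, w)) - log_barrier (u, v, w)
      = - (p * u) - q * v - r \<bullet> w + ln \<zeta> + ln v + (\<Sum>i\<in>UNIV. ln (w $ i))"
    by (simp add: log_barrier_def \<zeta>_def \<phi>_def)
  \<comment> \<open>all terms in \<open>\<zeta>\<close>, \<open>v\<close> and \<open>T\<close> cancel here\<close>
  also have "\<dots> \<le> ln (- 1 / p) + ln v0 + l0 - d - 2"
    using 1 2 3 4 unfolding pu qv rw by (simp add: algebra_simps)
  also have "\<dots> = - (p * u0) - q * v0 - r \<bullet> w0 + ln (v0 * \<phi>0 - u0) + ln v0 + l0"
  proof -
    have gap0: "v0 * \<phi>0 - u0 = - 1 / p" by (simp add: u0 \<phi>0_def)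
    show ?thesis unfolding gap0 pu0 qv0 rw0 by (simp add: algebra_simps)
  qed
  also have "\<dots> = - ((p, q, r) \<bullet> (u0, v0, w0)) - log_barrier (u0, v0, w0)"
    by (simp add: log_barrier_def \<phi>0_def l0_def)
  finally show ?thesis .
qed

definition log_conj_grad :: "real \<times> real \<times> (real ^ 'd) \<Rightarrow> real \<times> real \<times> (real ^ 'd)" where
  "log_conj_grad = (\<lambda>(p, q, r).
     ((- real CARD('d) - 2 + q / p + 2 * omega_bar p q r) / (p * (1 - omega_bar p q r)),
      - (1 / (p * (1 - omega_bar p q r))),
      (\<chi> i. omega_bar p q r / (r $ i * (1 - omega_bar p q r)))))"

text \<open>
  The negated formula solves the stationarity equations.  Only the equation for \<open>v\<close> depends on the
  choice of \<open>\<omega>\<close>, and it is the equation that \<open>omega_bar\<close> satisfies; \<open>\<omega> > 1\<close> and \<open>p < 0\<close> put the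
  point in the interior of the cone.
\<close>
lemma log_conj_grad_maximizer:
  fixes s :: "real \<times> real \<times> (real ^ 'd)"
  assumes s: "s \<in> interior (dual_cone log_cone)"
  shows "- log_conj_grad s \<in> interior log_cone"
    and "x \<in> interior log_cone \<Longrightarrow>
      - (s \<bullet> x) - log_barrier x \<le> - (s \<bullet> - log_conj_grad s) - log_barrier (- log_conj_grad s)"
proof -
  obtain p q r where se: "s = (p, q, r)" by (cases s)
  note s' = s[unfolded se]
  define d where "d = real CARD('d)"
  define \<omega> where "\<omega> = omega_bar p q r"
  have p: "p < 0" and r: "\<And>i. 0 < r $ i" using interior_dual_log_cone[OF s'] by auto
  have \<omega>: "1 < \<omega>" unfolding \<omega>_def using s' by (rule omega_bar_gt_one)
  define v0 where "v0 = 1 / (p * (1 - \<omega>))"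
  define w0 :: "real ^ 'd" where "w0 = (\<chi> i. \<omega> / (r $ i * (\<omega> - 1)))"
  define u0 where "u0 = v0 * sum_log (w0 /\<^sub>R v0) + 1 / p"
  have v0: "0 < v0" using p \<omega> by (simp add: v0_def mult_neg_neg)
  have w0: "0 < w0 $ i" for i using r[of i] \<omega> by (simp add: w0_def)
  have "ln (w0 $ i / v0) = ln \<omega> - ln (- (r $ i) / p)" for i
  proof -
    have "w0 $ i / v0 = \<omega> / (- (r $ i) / p)"
      using p \<omega> r[of i] by (simp add: w0_def v0_def field_simps)
    moreover have "0 < - (r $ i) / p" using p r[of i] by (simp add: divide_less_0_iff)
    ultimately show ?thesis using \<omega> by (simp only: ln_divide_pos)
  qed
  then have "sum_log (w0 /\<^sub>R v0) = d * ln \<omega> - (\<Sum>i\<in>UNIV. ln (- (r $ i) / p))"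
    by (simp add: sum_log_scaled sum_subtractf d_def)
  then have \<phi>0: "sum_log (w0 /\<^sub>R v0) = 1 + d - q / p - \<omega>"
    using omega_bar_equation(2)[of p q r] by (simp add: d_def \<omega>_def)
  have inv: "1 / v0 = p * (1 - \<omega>)" by (simp add: v0_def)
  have stat_w: "r $ i * w0 $ i = 1 - p * v0" for i
    using p \<omega> r[of i] by (simp add: w0_def v0_def field_simps)
  have stat_v: "q = 1 / v0 - p * (sum_log (w0 /\<^sub>R v0) - real CARD('d))"
    unfolding \<phi>0 inv using p by (simp add: d_def algebra_simps)
  have m: "- log_conj_grad s = (u0, v0, w0)"
  proof -
    have "u0 = - ((- d - 2 + q / p + 2 * \<omega>) / (p * (1 - \<omega>)))"
      unfolding u0_def \<phi>0 unfolding v0_def using p \<omega> by (simp add: divide_simps) (simp add: algebra_simps)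
    moreover have "w0 = - (\<chi> i. \<omega> / (r $ i * (1 - \<omega>)))"
      using \<omega> r by (simp add: vec_eq_iff w0_def divide_simps) (simp add: algebra_simps)
    ultimately show ?thesis by (simp add: log_conj_grad_def se v0_def d_def \<omega>_def)
  qed
  have "0 < log_gap (u0, v0, w0)" using p by (simp add: log_gap_def u0_def)
  then show "- log_conj_grad s \<in> interior log_cone"
    using v0 w0 by (simp add: m interior_log_cone log_domain_def)
  assume x: "x \<in> interior log_cone"
  obtain u v w where xe: "x = (u, v, w)" by (cases x)
  show "- (s \<bullet> x) - log_barrier x
      \<le> - (s \<bullet> - log_conj_grad s) - log_barrier (- log_conj_grad s)"
    unfolding m unfolding se xe
    by (rule log_barrier_stationary_point_maximal[OF p v0 w0 stat_w stat_v u0_def])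
       (use x in \<open>simp_all add: xe interior_log_cone\<close>)
qed

section \<open>The conjugate gradient\<close>

lemma isCont_log_conj_grad:
  fixes s :: "real \<times> real \<times> (real ^ 'd)"
  assumes s: "s \<in> interior (dual_cone log_cone)"
  shows "isCont log_conj_grad s"
proof -
  obtain p q r where se: "s = (p, q, r)" by (cases s)
  note s' = s[unfolded se]
  let ?\<omega> = "\<lambda>x :: real \<times> real \<times> (real ^ 'd). omega_bar (fst x) (fst (snd x)) (snd (snd x))"
  have p: "p < 0" and r: "\<And>i. 0 < r $ i" and \<omega>: "1 < omega_bar p q r"
    using interior_dual_log_cone[OF s'] omega_bar_gt_one[OF s'] by auto
  have [simp]: "p \<noteq> 0" "r $ i \<noteq> 0" "omega_bar p q r \<noteq> 1" for i using p r[of i] \<omega> by auto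
  have ratio: "- (r $ i) / p > 0" for i using p r[of i] by (simp add: divide_less_0_iff)
  have c: "isCont (\<lambda>x. 1 / real CARD('d) * (1 + real CARD('d) - fst (snd x) / fst x
      + (\<Sum>i\<in>UNIV. ln (- (snd (snd x) $ i) / fst x))) - ln (real CARD('d))) s"
    using ratio by (intro continuous_intros) (auto simp: se less_imp_neq[THEN not_sym])
  have [continuous_intros]: "isCont ?\<omega> s"
    unfolding omega_bar_def
    by (intro continuous_intros isCont_o2[OF c isCont_wright_omega])
  have [continuous_intros]: "isCont (\<lambda>x. \<chi> i. ?\<omega> x / (snd (snd x) $ i * (1 - ?\<omega> x))) s"
    unfolding isCont_def
  proof (rule vec_tendstoI)
    fix i
    have "isCont (\<lambda>x. ?\<omega> x / (snd (snd x) $ i * (1 - ?\<omega> x))) s"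
      by (intro continuous_intros) (simp add: se)
    then show "((\<lambda>x. (\<chi> i. ?\<omega> x / (snd (snd x) $ i * (1 - ?\<omega> x))) $ i)
        \<longlongrightarrow> (\<chi> i. ?\<omega> s / (snd (snd s) $ i * (1 - ?\<omega> s))) $ i) (at s)"
      by (simp add: isCont_def)
  qed
  have "isCont (\<lambda>x. ((- real CARD('d) - 2 + fst (snd x) / fst x + 2 * ?\<omega> x) / (fst x * (1 - ?\<omega> x)),
      - (1 / (fst x * (1 - ?\<omega> x))), (\<chi> i. ?\<omega> x / (snd (snd x) $ i * (1 - ?\<omega> x))))) s"
    by (intro continuous_intros) (auto simp: se)
  then show ?thesis by (simp add: log_conj_grad_def case_prod_unfold)
qed

theorem proposition3p1:
  fixes p q :: real and r :: "real ^ 'd"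
  assumes "(p, q, r) \<in> interior (dual_cone log_cone)"
  shows "GDERIV (conj_barrier log_cone log_barrier) (p, q, r)
           :> conj_gradient log_cone log_barrier (p, q, r) \<and>
         (case conj_gradient log_cone log_barrier (p, q, r) of (g_p, g_q, g_r) \<Rightarrow>
            g_p = (- real CARD('d) - 2 + q / p + 2 * omega_bar p q r) / (p * (1 - omega_bar p q r)) \<and>
            g_q = - (1 / (p * (1 - omega_bar p q r))) \<and>
            (\<forall>i. g_r $ i = omega_bar p q r / (r $ i * (1 - omega_bar p q r))))"
proof -
  have "GDERIV (conj_barrier log_cone log_barrier) (p, q, r) :> - (- log_conj_grad (p, q, r))"
    using assms
    by (intro GDERIV_conj_barrier[OF open_interior assms] continuous_minus log_conj_grad_maximizer isCont_log_conj_grad)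
  then have G: "GDERIV (conj_barrier log_cone log_barrier) (p, q, r) :> log_conj_grad (p, q, r)"
    by simp
  show ?thesis
    using G unfolding conj_gradient_eqI[OF G] by (simp add: log_conj_grad_def)
qed

end
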